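(* Let $m,n$ be fixed nonzero integers with $m+n\neq0$. Let $\mathcal{N}$ be a nest on a separable complex Hilbert space $H$ and $\mathrm{alg}\mathcal{N}$ the associated nest algebra. If $\delta:\mathrm{alg}\mathcal{N}\to\mathrm{alg}\mathcal{N}$ is an $(m,n)$-derivable mapping at $I$, then $\delta$ is a derivation.
   Context: A nest on $H$ is a totally ordered collection of closed subspaces of $H$ containing $(0)$ and $H$ and closed under arbitrary intersections and closed linear spans. $\mathrm{alg}\mathcal{N}$ is the algebra of all bounded linear operators on $H$ leaving every member of $\mathcal{N}$ invariant; $I$ is the identity operator. For a unital algebra $\mathcal{A}$ and $Z\in\mathcal{A}$, a linear map $\delta:\mathcal{A}\to\mathcal{A}$ is $(m,n)$-derivable at $Z$ if $m\delta(AB)+n\delta(BA)=m\delta(A)B+mA\delta(B)+n\delta(B)A+nB\delta(A)$ for all $A,B\in\mathcal{A}$ with $AB=Z$. It is a derivation if $\delta(AB)=\delta(A)B+A\delta(B)$ for all $A,B\in\mathcal{A}$. No continuity of $\delta$ is assumed. *)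

theory Defs
  imports "HOL-Analysis.Analysis"
begin

class scaleC = scaleR +
  fixes scaleC :: "complex \<Rightarrow> 'a \<Rightarrow> 'a"  (infixr \<open>*\<^sub>C\<close> 75)
  assumes scaleR_scaleC: "r *\<^sub>R x = complex_of_real r *\<^sub>C x"

class complex_vector = scaleC + ab_group_add +
  assumes scaleC_add_right: "a *\<^sub>C (x + y) = a *\<^sub>C x + a *\<^sub>C y"
    and scaleC_add_left: "(a + b) *\<^sub>C x = a *\<^sub>C x + b *\<^sub>C x"
    and scaleC_scaleC: "a *\<^sub>C b *\<^sub>C x = (a * b) *\<^sub>C x"
    and scaleC_one: "1 *\<^sub>C x = x"

class complex_normed_vector = complex_vector + real_normed_vector +
  assumes norm_scaleC: "norm (a *\<^sub>C x) = cmod a * norm x"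

text \<open>The inner product is linear in the first and antilinear in the second argument.
  Some axioms inherited from \<^class>\<open>complex_normed_vector\<close> are redundant here.\<close>

class complex_hilbert_space = complex_normed_vector + complete_space +
  fixes cinner :: "'a \<Rightarrow> 'a \<Rightarrow> complex"
  assumes cinner_commute: "cinner x y = cnj (cinner y x)"
    and cinner_add_left: "cinner (x + y) z = cinner x z + cinner y z"
    and cinner_scaleC_left: "cinner (a *\<^sub>C x) y = a * cinner x y"
    and cinner_self: "cinner x x = complex_of_real ((norm x)\<^sup>2)"

global_interpretation complex_vector:
  vector_space "scaleC :: complex \<Rightarrow> 'a \<Rightarrow> 'a::complex_vector"
  defines csubspace = complex_vector.subspace
    and cspan = complex_vector.span
  by unfold_locales (simp_all add: scaleC_add_right scaleC_add_left scaleC_scaleC scaleC_one)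

lemma bounded_linear_scaleC:
  "bounded_linear (\<lambda>x. c *\<^sub>C x :: 'a::complex_normed_vector)"
  by (rule bounded_linear_intro[where K = "cmod c"])
    (simp_all add: scaleC_add_right scaleR_scaleC scaleC_scaleC norm_scaleC mult.commute)

instantiation blinfun :: (real_normed_vector, complex_normed_vector) complex_vector
begin

lift_definition scaleC_blinfun :: "complex \<Rightarrow> 'a \<Rightarrow>\<^sub>L 'b \<Rightarrow> 'a \<Rightarrow>\<^sub>L 'b"
  is "\<lambda>c f x. c *\<^sub>C f x"
  by (rule bounded_linear_compose[OF bounded_linear_scaleC])

instance
  by standard
    (transfer, simp add: fun_eq_iff scaleR_scaleC scaleC_add_right scaleC_add_left
      scaleC_scaleC scaleC_one)+

end

text \<open>Elements of the library type of bounded linear operators are only required to be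
  real-linear; complex linearity is imposed by \<open>cblinfuns\<close> below.\<close>

definition cblinfuns :: "('a::complex_normed_vector \<Rightarrow>\<^sub>L 'a) set" where
  "cblinfuns = {A. \<forall>c x. blinfun_apply A (c *\<^sub>C x) = c *\<^sub>C blinfun_apply A x}"

definition nest :: "'a::complex_normed_vector set set \<Rightarrow> bool" where
  "nest \<N> \<longleftrightarrow>
     (\<forall>M\<in>\<N>. csubspace M \<and> closed M) \<and>
     chain\<^sub>\<subseteq> \<N> \<and>
     {0} \<in> \<N> \<and> UNIV \<in> \<N> \<and>
     (\<forall>\<F>\<subseteq>\<N>. \<Inter>\<F> \<in> \<N>) \<and>
     (\<forall>\<F>\<subseteq>\<N>. closure (cspan (\<Union>\<F>)) \<in> \<N>)"

definition nest_alg :: "'a::complex_normed_vector set set \<Rightarrow> ('a \<Rightarrow>\<^sub>L 'a) set" where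
  "nest_alg \<N> = {A \<in> cblinfuns. \<forall>M\<in>\<N>. blinfun_apply A ` M \<subseteq> M}"

text \<open>Below, \<open>\<A>\<close> is the carrier of an operator algebra with product \<open>o\<^sub>L\<close>; the values of
  \<open>\<delta>\<close> outside \<open>\<A>\<close> are irrelevant.\<close>

definition linear_self_map ::
    "('a::complex_normed_vector \<Rightarrow>\<^sub>L 'a) set \<Rightarrow> (('a \<Rightarrow>\<^sub>L 'a) \<Rightarrow> ('a \<Rightarrow>\<^sub>L 'a)) \<Rightarrow> bool" where
  "linear_self_map \<A> \<delta> \<longleftrightarrow>
     \<delta> ` \<A> \<subseteq> \<A> \<and>
     (\<forall>A\<in>\<A>. \<forall>B\<in>\<A>. \<delta> (A + B) = \<delta> A + \<delta> B) \<and>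
     (\<forall>c. \<forall>A\<in>\<A>. \<delta> (c *\<^sub>C A) = c *\<^sub>C \<delta> A)"

definition derivable_at ::
    "int \<Rightarrow> int \<Rightarrow> ('a::complex_normed_vector \<Rightarrow>\<^sub>L 'a) set \<Rightarrow> ('a \<Rightarrow>\<^sub>L 'a)
      \<Rightarrow> (('a \<Rightarrow>\<^sub>L 'a) \<Rightarrow> ('a \<Rightarrow>\<^sub>L 'a)) \<Rightarrow> bool" where
  "derivable_at m n \<A> Z \<delta> \<longleftrightarrow>
     linear_self_map \<A> \<delta> \<and>
     (\<forall>A\<in>\<A>. \<forall>B\<in>\<A>. A o\<^sub>L B = Z \<longrightarrow>
        of_int m *\<^sub>C \<delta> (A o\<^sub>L B) + of_int n *\<^sub>C \<delta> (B o\<^sub>L A) =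
        of_int m *\<^sub>C (\<delta> A o\<^sub>L B) + of_int m *\<^sub>C (A o\<^sub>L \<delta> B) +
        of_int n *\<^sub>C (\<delta> B o\<^sub>L A) + of_int n *\<^sub>C (B o\<^sub>L \<delta> A))"

definition derivation ::
    "('a::complex_normed_vector \<Rightarrow>\<^sub>L 'a) set \<Rightarrow> (('a \<Rightarrow>\<^sub>L 'a) \<Rightarrow> ('a \<Rightarrow>\<^sub>L 'a)) \<Rightarrow> bool" where
  "derivation \<A> \<delta> \<longleftrightarrow>
     linear_self_map \<A> \<delta> \<and>
     (\<forall>A\<in>\<A>. \<forall>B\<in>\<A>. \<delta> (A o\<^sub>L B) = (\<delta> A o\<^sub>L B) + (A o\<^sub>L \<delta> B))"

end

(*
  For invertible x, adding the hypothesis for (x, x\<inverse>) and for (x\<inverse>, x) and cancelling m + n leaves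
  the Jordan product rule for x \<circ> x\<inverse>. On a resolvent r(t) = (1 - tT)\<inverse> it is a linear equation for
  \<delta>(r(t)) which is uniquely solvable for small t, so that
  \<delta>(r(t)) = t \<delta>(T) + t\<^sup>2 (\<delta>(T)T + T\<delta>(T)) + o(t\<^sup>2)
  even if \<delta> is discontinuous. Since (r(t) + r(-t))/2 is the resolvent of T\<^sup>2 at t\<^sup>2, comparing the
  coefficients of t\<^sup>2 gives \<delta>(T\<^sup>2) = \<delta>(T)T + T\<delta>(T), so \<delta> is a Jordan derivation. If the nest is
  trivial, the algebra is prime and Herstein's argument applies; otherwise the orthogonal projection
  onto a nontrivial member M makes the algebra triangular with a faithful corner, as the rank-one
  operators from the complement of M into M lie in it, and the Peirce decomposition does the rest.
*)

theory Submission
  imports Defs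
begin

section \<open>Ring arithmetic of bounded operators under composition\<close>

lemma blinfun_compose_assoc: "(x o\<^sub>L y) o\<^sub>L z = x o\<^sub>L (y o\<^sub>L z)"
  by (rule blinfun_eqI) simp

lemma blinfun_compose_id [simp]: "id_blinfun o\<^sub>L x = x" "x o\<^sub>L id_blinfun = x"
  by (auto intro: blinfun_eqI)

text \<open>Normalises noncommutative polynomials in operators: the bilinearity rules expand
  products, \<open>algebra_simps\<close> sorts the resulting sums.\<close>

lemmas blinfun_ring_simps =
  blinfun_compose_assoc
  bounded_bilinear.add_left [OF bounded_bilinear_blinfun_compose]
  bounded_bilinear.add_right [OF bounded_bilinear_blinfun_compose]
  bounded_bilinear.diff_left [OF bounded_bilinear_blinfun_compose]
  bounded_bilinear.diff_right [OF bounded_bilinear_blinfun_compose]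
  bounded_bilinear.minus_left [OF bounded_bilinear_blinfun_compose]
  bounded_bilinear.minus_right [OF bounded_bilinear_blinfun_compose]
  bounded_bilinear.scaleR_left [OF bounded_bilinear_blinfun_compose]
  bounded_bilinear.scaleR_right [OF bounded_bilinear_blinfun_compose]
  algebra_simps

text \<open>Absence of 2-torsion, the form in which Jordan identities get divided by 2.\<close>

lemma real_vector_double_cancel: "x + x = y + y \<Longrightarrow> x = y" for x y :: "'a::real_vector"
  by (simp flip: scaleR_2)

section \<open>Jordan derivations\<close>

text \<open>A is only a unital ring of operators and \<delta> only additive: everything in this
  locale is ring theory without 2-torsion.\<close>

locale jordan_derivation_on =
  fixes A :: "('a::real_normed_vector \<Rightarrow>\<^sub>L 'a) set"
    and \<delta> :: "('a \<Rightarrow>\<^sub>L 'a) \<Rightarrow> ('a \<Rightarrow>\<^sub>L 'a)"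
  assumes id_mem [simp]: "id_blinfun \<in> A"
    and diff_mem [simp]: "x \<in> A \<Longrightarrow> y \<in> A \<Longrightarrow> x - y \<in> A"
    and comp_mem [simp]: "x \<in> A \<Longrightarrow> y \<in> A \<Longrightarrow> x o\<^sub>L y \<in> A"
    and \<delta>_mem [simp]: "x \<in> A \<Longrightarrow> \<delta> x \<in> A"
    and \<delta>_add: "x \<in> A \<Longrightarrow> y \<in> A \<Longrightarrow> \<delta> (x + y) = \<delta> x + \<delta> y"
    and \<delta>_square: "x \<in> A \<Longrightarrow> \<delta> (x o\<^sub>L x) = (\<delta> x o\<^sub>L x) + (x o\<^sub>L \<delta> x)"
begin

lemma zero_mem [simp]: "0 \<in> A"
  using diff_mem [OF id_mem id_mem] by simp

lemma minus_mem [simp]: "x \<in> A \<Longrightarrow> - x \<in> A"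
  using diff_mem [OF zero_mem] by simp

lemma add_mem [simp]: "x \<in> A \<Longrightarrow> y \<in> A \<Longrightarrow> x + y \<in> A"
  using diff_mem [OF _ minus_mem] by simp

lemma \<delta>_zero [simp]: "\<delta> 0 = 0"
  using \<delta>_add [of 0 0] by simp

lemma \<delta>_minus: "x \<in> A \<Longrightarrow> \<delta> (- x) = - \<delta> x"
  using \<delta>_add [of x "- x"] by (simp add: add_eq_0_iff2)

lemma \<delta>_diff: "x \<in> A \<Longrightarrow> y \<in> A \<Longrightarrow> \<delta> (x - y) = \<delta> x - \<delta> y"
  using \<delta>_add [of x "- y"] by (simp add: \<delta>_minus)

lemma \<delta>_id [simp]: "\<delta> id_blinfun = 0"
  using \<delta>_square [of id_blinfun] by simp

text \<open>Polarisation of \<open>\<delta>_square\<close>: expand the square of x + y and cancel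
  the two pure squares.\<close>

lemma \<delta>_jordan:
  assumes [simp]: "x \<in> A" "y \<in> A"
  shows "\<delta> (x o\<^sub>L y) + \<delta> (y o\<^sub>L x) =
    (\<delta> x o\<^sub>L y) + (x o\<^sub>L \<delta> y) + (\<delta> y o\<^sub>L x) + (y o\<^sub>L \<delta> x)"
proof -
  have "(x + y) o\<^sub>L (x + y) = ((x o\<^sub>L x) + (y o\<^sub>L y)) + ((x o\<^sub>L y) + (y o\<^sub>L x))"
    by (simp add: blinfun_ring_simps)
  then have "\<delta> ((x + y) o\<^sub>L (x + y)) = \<delta> (x o\<^sub>L x) + \<delta> (y o\<^sub>L y) + (\<delta> (x o\<^sub>L y) + \<delta> (y o\<^sub>L x))"
    by (simp add: \<delta>_add)
  then show ?thesis
    by (simp add: \<delta>_square \<delta>_add) (simp add: blinfun_ring_simps)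
qed

text \<open>With w = xy + yx one has xw + wx = xxy + yxx + 2xyx. Applying
  \<open>\<delta>_jordan\<close> to the pairs (x, w) and (xx, y) isolates 2\<delta>(xyx).\<close>

lemma \<delta>_sandwich:
  assumes [simp]: "x \<in> A" "y \<in> A"
  shows "\<delta> (x o\<^sub>L y o\<^sub>L x) = (\<delta> x o\<^sub>L y o\<^sub>L x) + (x o\<^sub>L \<delta> y o\<^sub>L x) + (x o\<^sub>L y o\<^sub>L \<delta> x)"
proof -
  let ?w = "(x o\<^sub>L y) + (y o\<^sub>L x)"
  have \<delta>_w: "\<delta> ?w = (\<delta> x o\<^sub>L y) + (x o\<^sub>L \<delta> y) + (\<delta> y o\<^sub>L x) + (y o\<^sub>L \<delta> x)"
    by (simp add: \<delta>_add \<delta>_jordan)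
  have "\<delta> (x o\<^sub>L ?w) + \<delta> (?w o\<^sub>L x) =
      \<delta> (x o\<^sub>L x o\<^sub>L y) + \<delta> (y o\<^sub>L (x o\<^sub>L x)) + (\<delta> (x o\<^sub>L y o\<^sub>L x) + \<delta> (x o\<^sub>L y o\<^sub>L x))"
    by (simp add: blinfun_ring_simps \<delta>_add)
  then have "\<delta> (x o\<^sub>L y o\<^sub>L x) + \<delta> (x o\<^sub>L y o\<^sub>L x) =
      (\<delta> x o\<^sub>L ?w) + (x o\<^sub>L \<delta> ?w) + (\<delta> ?w o\<^sub>L x) + (?w o\<^sub>L \<delta> x) -
      ((\<delta> (x o\<^sub>L x) o\<^sub>L y) + (x o\<^sub>L x o\<^sub>L \<delta> y) + (\<delta> y o\<^sub>L (x o\<^sub>L x)) + (y o\<^sub>L \<delta> (x o\<^sub>L x)))"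
    using \<delta>_jordan [of x ?w] \<delta>_jordan [of "x o\<^sub>L x" y] by (simp add: algebra_simps)
  also have "\<dots> = ((\<delta> x o\<^sub>L y o\<^sub>L x) + (x o\<^sub>L \<delta> y o\<^sub>L x) + (x o\<^sub>L y o\<^sub>L \<delta> x)) +
      ((\<delta> x o\<^sub>L y o\<^sub>L x) + (x o\<^sub>L \<delta> y o\<^sub>L x) + (x o\<^sub>L y o\<^sub>L \<delta> x))"
    unfolding \<delta>_w by (simp add: \<delta>_square blinfun_ring_simps)
  finally show ?thesis
    by (rule real_vector_double_cancel)
qed

text \<open>Polarisation of \<open>\<delta>_sandwich\<close> in the outer factor, replacing x by x +
  z.\<close>

lemma \<delta>_triple:
  assumes [simp]: "x \<in> A" "y \<in> A" "z \<in> A"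
  shows "\<delta> (x o\<^sub>L y o\<^sub>L z) + \<delta> (z o\<^sub>L y o\<^sub>L x) =
    (\<delta> x o\<^sub>L y o\<^sub>L z) + (x o\<^sub>L \<delta> y o\<^sub>L z) + (x o\<^sub>L y o\<^sub>L \<delta> z) +
    (\<delta> z o\<^sub>L y o\<^sub>L x) + (z o\<^sub>L \<delta> y o\<^sub>L x) + (z o\<^sub>L y o\<^sub>L \<delta> x)"
proof -
  have "(x + z) o\<^sub>L y o\<^sub>L (x + z) =
      ((x o\<^sub>L y o\<^sub>L x) + (z o\<^sub>L y o\<^sub>L z)) + ((x o\<^sub>L y o\<^sub>L z) + (z o\<^sub>L y o\<^sub>L x))"
    by (simp add: blinfun_ring_simps)
  then have "\<delta> ((x + z) o\<^sub>L y o\<^sub>L (x + z)) =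
      \<delta> (x o\<^sub>L y o\<^sub>L x) + \<delta> (z o\<^sub>L y o\<^sub>L z) + (\<delta> (x o\<^sub>L y o\<^sub>L z) + \<delta> (z o\<^sub>L y o\<^sub>L x))"
    by (simp add: \<delta>_add)
  then show ?thesis
    by (simp add: \<delta>_sandwich \<delta>_add) (simp add: blinfun_ring_simps)
qed

section \<open>The failure of the product rule, and Herstein's theorem for prime rings\<close>

definition defect :: "('a \<Rightarrow>\<^sub>L 'a) \<Rightarrow> ('a \<Rightarrow>\<^sub>L 'a) \<Rightarrow> ('a \<Rightarrow>\<^sub>L 'a)" where
  "defect x y = \<delta> (x o\<^sub>L y) - (\<delta> x o\<^sub>L y) - (x o\<^sub>L \<delta> y)"

lemma defect_mem [simp]: "x \<in> A \<Longrightarrow> y \<in> A \<Longrightarrow> defect x y \<in> A"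
  by (simp add: defect_def)

lemma defect_add_left:
  "x \<in> A \<Longrightarrow> x' \<in> A \<Longrightarrow> y \<in> A \<Longrightarrow> defect (x + x') y = defect x y + defect x' y"
  by (simp add: defect_def \<delta>_add blinfun_ring_simps)

lemma defect_add_right:
  "x \<in> A \<Longrightarrow> y \<in> A \<Longrightarrow> y' \<in> A \<Longrightarrow> defect x (y + y') = defect x y + defect x y'"
  by (simp add: defect_def \<delta>_add blinfun_ring_simps)

lemma defect_swap: "x \<in> A \<Longrightarrow> y \<in> A \<Longrightarrow> defect y x = - defect x y"
  using \<delta>_jordan [of x y] by (simp add: defect_def algebra_simps)

text \<open>Up to sign, \<open>defect\<close> is the Hochschild coboundary of \<delta>, and this is
  the 2-cocycle identity. In the triangular case it reduces the diagonal Peirce components to the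
  mixed ones.\<close>

lemma defect_cocycle:
  "(defect x y o\<^sub>L z) = defect x (y o\<^sub>L z) - defect (x o\<^sub>L y) z + (x o\<^sub>L defect y z)"
  by (simp add: defect_def blinfun_ring_simps)

text \<open>Evaluate \<open>\<delta> (xyzyx + yxzxy)\<close> both as a triple product in \<open>xy, z, yx\<close> and as a sum of
  two nested sandwiches.\<close>

lemma defect_commutator:
  assumes [simp]: "x \<in> A" "y \<in> A" "z \<in> A"
  defines "c \<equiv> (x o\<^sub>L y) - (y o\<^sub>L x)"
  shows "(defect x y o\<^sub>L z o\<^sub>L c) + (c o\<^sub>L z o\<^sub>L defect x y) = 0"
proof -
  have "\<delta> ((x o\<^sub>L y) o\<^sub>L z o\<^sub>L (y o\<^sub>L x)) + \<delta> ((y o\<^sub>L x) o\<^sub>L z o\<^sub>L (x o\<^sub>L y)) =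
      \<delta> (x o\<^sub>L (y o\<^sub>L z o\<^sub>L y) o\<^sub>L x) + \<delta> (y o\<^sub>L (x o\<^sub>L z o\<^sub>L x) o\<^sub>L y)"
    by (simp add: blinfun_compose_assoc)
  then have "(defect x y o\<^sub>L z o\<^sub>L (y o\<^sub>L x)) + ((x o\<^sub>L y) o\<^sub>L z o\<^sub>L defect y x) +
      (defect y x o\<^sub>L z o\<^sub>L (x o\<^sub>L y)) + ((y o\<^sub>L x) o\<^sub>L z o\<^sub>L defect x y) = 0"
    by (simp add: \<delta>_triple \<delta>_sandwich) (simp add: defect_def blinfun_ring_simps)
  then show ?thesis
    unfolding defect_swap [OF assms(1,2)] c_def by (simp add: blinfun_ring_simps)
qed

text \<open>By \<open>defect_commutator\<close>, primeness in the symmetrised form assumed here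
  kills the defect of every noncommuting pair. Biadditivity then extends this to all pairs, by
  perturbing first the second and then the first argument.\<close>

theorem prime_imp_derivation:
  assumes prime: "\<And>a b. a \<in> A \<Longrightarrow> b \<in> A \<Longrightarrow>
      (\<And>z. z \<in> A \<Longrightarrow> (a o\<^sub>L z o\<^sub>L b) + (b o\<^sub>L z o\<^sub>L a) = 0) \<Longrightarrow> a = 0 \<or> b = 0"
    and [simp]: "x \<in> A" "y \<in> A"
  shows "\<delta> (x o\<^sub>L y) = (\<delta> x o\<^sub>L y) + (x o\<^sub>L \<delta> y)"
proof -
  have noncomm: "defect u v = 0" if "u \<in> A" "v \<in> A" "u o\<^sub>L v \<noteq> v o\<^sub>L u" for u v
    using prime [OF _ _ defect_commutator [OF that(1,2)]] that by auto
  have noncentral: "defect u v = 0"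
    if [simp]: "u \<in> A" "v \<in> A" "w \<in> A" and w: "u o\<^sub>L w \<noteq> w o\<^sub>L u" for u v w
  proof (cases "u o\<^sub>L v = v o\<^sub>L u")
    case True
    \<comment> \<open>Both (u, v + w) and (u, w) are noncommuting pairs, and the defect of (u, v) is
      the difference of theirs.\<close>
    then have "u o\<^sub>L (v + w) \<noteq> (v + w) o\<^sub>L u"
      using w by (simp add: blinfun_ring_simps)
    then have "defect u (v + w) = 0"
      by (intro noncomm) auto
    then show ?thesis
      using noncomm [OF _ _ w] by (simp add: defect_add_right)
  qed (auto intro: noncomm)
  have "defect x y = 0"
  proof (cases "\<exists>u\<in>A. \<exists>w\<in>A. u o\<^sub>L w \<noteq> w o\<^sub>L u")
    case True
    then obtain u w where [simp]: "u \<in> A" "w \<in> A" and uw: "u o\<^sub>L w \<noteq> w o\<^sub>L u" by blast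
    show ?thesis
    proof (cases "x o\<^sub>L w = w o\<^sub>L x")
      case True
      \<comment> \<open>Here x + u and u both fail to commute with w, so the defects of (x + u, y)
        and (u, y) vanish, and with them their difference.\<close>
      then have "(x + u) o\<^sub>L w \<noteq> w o\<^sub>L (x + u)"
        using uw by (simp add: blinfun_ring_simps)
      then have "defect (x + u) y = 0"
        by (intro noncentral [of _ _ w]) auto
      then show ?thesis
        using noncentral [OF _ _ _ uw, of y] by (simp add: defect_add_left)
    qed (auto intro: noncentral [of _ _ w])
  next
    case False
    \<comment> \<open>In a commutative ring the defect is symmetric; by \<open>defect_swap\<close>
      it is also antisymmetric.\<close>
    then have "defect y x = defect x y"
      using \<delta>_mem [OF assms(2)] \<delta>_mem [OF assms(3)] assms(2,3)
      by (simp add: defect_def algebra_simps)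
    then have "defect x y + defect x y = 0 + 0"
      using defect_swap [OF assms(2,3)] by (metis add.right_inverse add_0)
    then show ?thesis by (rule real_vector_double_cancel)
  qed
  then show ?thesis
    by (simp add: defect_def algebra_simps)
qed

text \<open>By \<open>tri\<close> the corner (1 - p)Ap is zero, and px - xp = px(1 - p) runs through
  pA(1 - p). The faithfulness hypotheses thus concern the left action of pAp and the right action of
  (1 - p)A(1 - p) on that corner. Since \<delta> p = 0, \<delta> preserves each Peirce component, so
  the defect can be computed componentwise.\<close>

lemma triangular_imp_derivation_aux:
  assumes p [simp]: "p \<in> A" and idem: "p o\<^sub>L p = p" and \<delta>p [simp]: "\<delta> p = 0"
    and tri: "\<And>x. x \<in> A \<Longrightarrow> p o\<^sub>L x o\<^sub>L p = x o\<^sub>L p"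
    and faithful_left: "\<And>d. d \<in> A \<Longrightarrow> (\<And>x. x \<in> A \<Longrightarrow> d o\<^sub>L ((p o\<^sub>L x) - (x o\<^sub>L p)) = 0) \<Longrightarrow> d o\<^sub>L p = 0"
    and faithful_right: "\<And>d. d \<in> A \<Longrightarrow> (\<And>x. x \<in> A \<Longrightarrow> ((p o\<^sub>L x) - (x o\<^sub>L p)) o\<^sub>L d = 0) \<Longrightarrow> p o\<^sub>L d = d"
    and x [simp]: "x \<in> A" and y [simp]: "y \<in> A"
  shows "defect x y = 0"
proof -
  \<comment> \<open>The Peirce components pAp, pA(1 - p) and (1 - p)A(1 - p).\<close>
  define P11 where "P11 = {a \<in> A. p o\<^sub>L a = a \<and> a o\<^sub>L p = a}"
  define P12 where "P12 = {a \<in> A. p o\<^sub>L a = a \<and> a o\<^sub>L p = 0}"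
  define P22 where "P22 = {a \<in> A. p o\<^sub>L a = 0 \<and> a o\<^sub>L p = 0}"
  note P_defs = P11_def P12_def P22_def
  have idem': "p o\<^sub>L p = p" "p o\<^sub>L (p o\<^sub>L v) = p o\<^sub>L v" for v
    by (simp_all add: idem flip: blinfun_compose_assoc)
  have left_fix: "p o\<^sub>L (a o\<^sub>L v) = a o\<^sub>L v" if "p o\<^sub>L a = a" for a v
    using that by (simp flip: blinfun_compose_assoc)
  have left_kill: "p o\<^sub>L (a o\<^sub>L v) = 0" if "p o\<^sub>L a = 0" for a v
    using that by (simp flip: blinfun_compose_assoc)
  have P_mem: "a \<in> P11 \<Longrightarrow> a \<in> A" "a \<in> P12 \<Longrightarrow> a \<in> A" "a \<in> P22 \<Longrightarrow> a \<in> A" for a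
    by (auto simp: P_defs)

  have \<delta>_P11 [simp]: "\<delta> a \<in> P11" if "a \<in> P11" for a
  proof -
    have "\<delta> (p o\<^sub>L a o\<^sub>L p) = p o\<^sub>L \<delta> a o\<^sub>L p"
      using that by (simp add: P_mem \<delta>_sandwich)
    then have *: "\<delta> a = p o\<^sub>L (\<delta> a o\<^sub>L p)"
      using that by (simp add: P_defs blinfun_compose_assoc)
    have "p o\<^sub>L \<delta> a = \<delta> a" "\<delta> a o\<^sub>L p = \<delta> a"
      by (subst (1 2) *, simp add: blinfun_compose_assoc idem')+
    then show ?thesis using that by (simp add: P11_def)
  qed
  have \<delta>_P22 [simp]: "\<delta> a \<in> P22" if "a \<in> P22" for a
  proof -
    let ?q = "id_blinfun - p"
    have "\<delta> (?q o\<^sub>L a o\<^sub>L ?q) = ?q o\<^sub>L \<delta> a o\<^sub>L ?q"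
      using that by (simp add: P_mem \<delta>_sandwich \<delta>_diff)
    moreover have "?q o\<^sub>L a o\<^sub>L ?q = a"
      using that by (simp add: P_defs blinfun_ring_simps)
    ultimately have *: "\<delta> a = ?q o\<^sub>L \<delta> a o\<^sub>L ?q" by simp
    have "p o\<^sub>L \<delta> a = 0" "\<delta> a o\<^sub>L p = 0"
      by (subst *, simp add: blinfun_ring_simps idem')+
    then show ?thesis using that by (simp add: P22_def)
  qed
  have \<delta>_P12 [simp]: "\<delta> a \<in> P12" if "a \<in> P12" for a
  proof -
    let ?q = "id_blinfun - p"
    \<comment> \<open>The triple identity with outer factors p and 1 - p, both killed by \<delta>.
      The reversed products (1 - p)ap and (1 - p)\<delta>(a)p vanish, the latter by
      \<open>tri\<close>.\<close>
    have "\<delta> (p o\<^sub>L a o\<^sub>L ?q) + \<delta> (?q o\<^sub>L a o\<^sub>L p) = (p o\<^sub>L \<delta> a o\<^sub>L ?q) + (?q o\<^sub>L \<delta> a o\<^sub>L p)"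
      using that by (simp add: P_mem \<delta>_triple \<delta>_diff)
    moreover have "p o\<^sub>L a o\<^sub>L ?q = a" "?q o\<^sub>L a o\<^sub>L p = 0"
      using that by (simp_all add: P_defs blinfun_ring_simps)
    moreover have "?q o\<^sub>L \<delta> a o\<^sub>L p = 0"
      using tri [of "\<delta> a"] that by (simp add: P_mem blinfun_ring_simps)
    ultimately have *: "\<delta> a = p o\<^sub>L \<delta> a o\<^sub>L ?q" by simp
    have "p o\<^sub>L \<delta> a = \<delta> a" "\<delta> a o\<^sub>L p = 0"
      by (subst (1 2) *, simp add: blinfun_ring_simps idem',
          subst *, simp add: blinfun_ring_simps idem')
    then show ?thesis using that by (simp add: P12_def)
  qed

  have mult0: "u o\<^sub>L v = 0"
    if "u \<in> P11 \<and> v \<in> P22 \<or> u \<in> P12 \<union> P22 \<and> v \<in> P11 \<union> P12" for u v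
  proof -
    have "(u o\<^sub>L p) o\<^sub>L v = u o\<^sub>L (p o\<^sub>L v)" by (rule blinfun_compose_assoc)
    then show ?thesis using that by (auto simp: P_defs)
  qed
  have defect0: "defect u v = 0"
    if "u \<in> P11 \<and> v \<in> P22 \<or> u \<in> P12 \<union> P22 \<and> v \<in> P11 \<union> P12" for u v
  proof -
    have "u o\<^sub>L v = 0" "\<delta> u o\<^sub>L v = 0" "u o\<^sub>L \<delta> v = 0"
      by (rule mult0, use that in auto)+
    then show ?thesis by (simp add: defect_def)
  qed
  \<comment> \<open>The product am may be nonzero, but ma is zero; antisymmetry of the defect
    carries the vanishing over from (m, a).\<close>
  have defect_11_12: "defect a m = 0" if "a \<in> P11" "m \<in> P12" for a m
    using defect_swap [of m a] defect0 [of m a] that by (simp add: P_mem)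
  have defect_12_22: "defect m b = 0" if "m \<in> P12" "b \<in> P22" for m b
    using defect_swap [of b m] defect0 [of b m] that by (simp add: P_mem)
  have corner: "(p o\<^sub>L x) - (x o\<^sub>L p) \<in> P12" if "x \<in> A" for x
    using tri [OF that] that by (simp add: P_defs blinfun_ring_simps idem')

  have defect_11_11: "defect a a' = 0" if a: "a \<in> P11" "a' \<in> P11" for a a'
  proof -
    have prods: "a o\<^sub>L a' \<in> P11"
        using a by (auto simp: P_defs blinfun_compose_assoc left_fix left_kill)
    have "defect a a' o\<^sub>L m = 0" if "m \<in> P12" for m
    proof -
      have "a' o\<^sub>L m \<in> P12"
        using a that by (auto simp: P_defs blinfun_compose_assoc left_fix left_kill)
      \<comment> \<open>In the cocycle identity for a, a', m, each term on the right contains a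
        defect of a pair from P11 and P12.\<close>
      then show ?thesis
        using defect_11_12 [OF prods that] defect_11_12 [OF a(1), of "a' o\<^sub>L m"]
          defect_11_12 [OF a(2) that]
        by (simp add: defect_cocycle)
    qed
    then have "defect a a' o\<^sub>L p = 0"
      using a corner by (intro faithful_left) (auto simp: P_mem)
    moreover have "defect a a' o\<^sub>L p = defect a a'"
      using a \<delta>_P11 [OF prods] \<delta>_P11 [OF a(1)] \<delta>_P11 [OF a(2)]
      by (simp add: P_defs defect_def blinfun_ring_simps)
    ultimately show ?thesis by simp
  qed
  have defect_22_22: "defect b b' = 0" if b: "b \<in> P22" "b' \<in> P22" for b b'
  proof -
    have prods: "b o\<^sub>L b' \<in> P22"
        using b by (auto simp: P_defs blinfun_compose_assoc left_fix left_kill)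
    have "m o\<^sub>L defect b b' = 0" if "m \<in> P12" for m
    proof -
      have "m o\<^sub>L b \<in> P12"
        using b that by (auto simp: P_defs blinfun_compose_assoc left_fix left_kill)
      \<comment> \<open>Mirror image of the preceding case: the cocycle identity for m, b, b'
        expresses m times the defect of (b, b') by defects of pairs from P12 and P22.\<close>
      then show ?thesis
        using defect_12_22 [OF that prods] defect_12_22 [OF _ b(2), of "m o\<^sub>L b"]
          defect_12_22 [OF that b(1)]
        using defect_cocycle [of m b b'] by simp
    qed
    then have "p o\<^sub>L defect b b' = defect b b'"
      using b corner by (intro faithful_right) (auto simp: P_mem)
    moreover have "p o\<^sub>L defect b b' = 0"
      using b \<delta>_P22 [OF prods] \<delta>_P22 [OF b(1)] \<delta>_P22 [OF b(2)]
      by (simp add: P_defs defect_def blinfun_ring_simps left_kill)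
    ultimately show ?thesis by simp
  qed

  have decomp: "\<exists>a\<in>P11. \<exists>m\<in>P12. \<exists>b\<in>P22. x = a + m + b" if "x \<in> A" for x
  proof (intro bexI)
    show "x = (x o\<^sub>L p) + ((p o\<^sub>L x) - (x o\<^sub>L p)) + (x - (p o\<^sub>L x))" by simp
    show "x o\<^sub>L p \<in> P11" "x - (p o\<^sub>L x) \<in> P22"
      using tri [OF that] that by (simp_all add: P_defs blinfun_ring_simps idem')
  qed (rule corner [OF that])
  obtain a m b where "x = a + m + b" and abm: "a \<in> P11" "m \<in> P12" "b \<in> P22"
    using decomp [OF x] by blast
  moreover obtain a' m' b' where "y = a' + m' + b'" and "a' \<in> P11" "m' \<in> P12" "b' \<in> P22"
    using decomp [OF y] by blast
  ultimately show ?thesis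
    by (simp add: P_mem defect_add_left defect_add_right defect0 defect_11_12 defect_12_22
        defect_11_11 defect_22_22)
qed

end

text \<open>Subtracting the inner derivation \<open>x \<mapsto> xs - sx\<close> with \<open>s = \<delta> p = p s (1 - p)\<close> reduces to the
  case \<open>\<delta> p = 0\<close>, in which \<open>\<delta>\<close> respects the Peirce decomposition with respect to \<open>p\<close>.\<close>

theorem (in jordan_derivation_on) triangular_imp_derivation:
  assumes p [simp]: "p \<in> A" and idem: "p o\<^sub>L p = p"
    and tri: "\<And>x. x \<in> A \<Longrightarrow> p o\<^sub>L x o\<^sub>L p = x o\<^sub>L p"
    and faithful_left: "\<And>d. d \<in> A \<Longrightarrow>
      (\<And>x. x \<in> A \<Longrightarrow> d o\<^sub>L ((p o\<^sub>L x) - (x o\<^sub>L p)) = 0) \<Longrightarrow> d o\<^sub>L p = 0"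
    and faithful_right: "\<And>d. d \<in> A \<Longrightarrow>
      (\<And>x. x \<in> A \<Longrightarrow> ((p o\<^sub>L x) - (x o\<^sub>L p)) o\<^sub>L d = 0) \<Longrightarrow> p o\<^sub>L d = d"
    and [simp]: "x \<in> A" "y \<in> A"
  shows "\<delta> (x o\<^sub>L y) = (\<delta> x o\<^sub>L y) + (x o\<^sub>L \<delta> y)"
proof -
  define s where "s = \<delta> p"
  have s [simp]: "s \<in> A" by (simp add: s_def)
  have s_eq: "(s o\<^sub>L p) + (p o\<^sub>L s) = s"
    using \<delta>_square [OF p] by (simp add: idem s_def)
  \<comment> \<open>Multiplying s = sp + ps by p on the left leaves psp = 0, and psp = sp by
    \<open>tri\<close>.\<close>
  have "(p o\<^sub>L s o\<^sub>L p) + (p o\<^sub>L p o\<^sub>L s) = p o\<^sub>L ((s o\<^sub>L p) + (p o\<^sub>L s))"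
    by (simp add: blinfun_ring_simps)
  also have "\<dots> = p o\<^sub>L s" by (simp only: s_eq)
  finally have sp: "s o\<^sub>L p = 0"
    by (simp add: idem tri)
  with s_eq have ps: "p o\<^sub>L s = s" by simp
  define \<delta>' where "\<delta>' x = \<delta> x - ((x o\<^sub>L s) - (s o\<^sub>L x))" for x
  interpret inner: jordan_derivation_on A \<delta>'
    by unfold_locales (auto simp: \<delta>'_def \<delta>_add \<delta>_square blinfun_ring_simps)
  have \<delta>'p: "\<delta>' p = 0"
    by (simp add: \<delta>'_def sp ps flip: s_def)
  have "inner.defect x y = 0"
    by (rule inner.triangular_imp_derivation_aux [OF p idem \<delta>'p tri faithful_left faithful_right])
      simp_all
  \<comment> \<open>Inner derivations satisfy the product rule, so \<delta> and \<delta>' have the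
    same defect.\<close>
  then show ?thesis
    by (simp add: inner.defect_def \<delta>'_def blinfun_ring_simps)
qed

section \<open>Maps that behave like Jordan derivations on inverses\<close>

text \<open>Closedness serves to construct resolvents inside A. Real homogeneity of \<delta> is
  enough because the resolvent parameter is real.\<close>

locale inverse_jordan_on =
  fixes A :: "('a::banach \<Rightarrow>\<^sub>L 'a) set"
    and \<delta> :: "('a \<Rightarrow>\<^sub>L 'a) \<Rightarrow> ('a \<Rightarrow>\<^sub>L 'a)"
  assumes closed: "closed A"
    and subspace: "subspace A"
    and id_mem [simp]: "id_blinfun \<in> A"
    and comp_mem [simp]: "x \<in> A \<Longrightarrow> y \<in> A \<Longrightarrow> x o\<^sub>L y \<in> A"
    and \<delta>_add: "x \<in> A \<Longrightarrow> y \<in> A \<Longrightarrow> \<delta> (x + y) = \<delta> x + \<delta> y"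
    and \<delta>_scaleR: "x \<in> A \<Longrightarrow> \<delta> (r *\<^sub>R x) = r *\<^sub>R \<delta> x"
    and \<delta>_inverse: "x \<in> A \<Longrightarrow> y \<in> A \<Longrightarrow> x o\<^sub>L y = id_blinfun \<Longrightarrow> y o\<^sub>L x = id_blinfun \<Longrightarrow>
      (\<delta> x o\<^sub>L y) + (x o\<^sub>L \<delta> y) + (\<delta> y o\<^sub>L x) + (y o\<^sub>L \<delta> x) = 0"
begin

lemmas subspace_mems [simp] =
  subspace_add [OF subspace] subspace_diff [OF subspace] subspace_scale [OF subspace]

lemma \<delta>_diff: "x \<in> A \<Longrightarrow> y \<in> A \<Longrightarrow> \<delta> (x - y) = \<delta> x - \<delta> y"
  using \<delta>_add [of "x - y" y] by simp

lemma \<delta>_id: "\<delta> id_blinfun = 0"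
proof -
  have "(\<delta> id_blinfun + \<delta> id_blinfun) + (\<delta> id_blinfun + \<delta> id_blinfun) = 0 + 0"
    using \<delta>_inverse [of id_blinfun id_blinfun] by (simp add: add.assoc)
  then have "\<delta> id_blinfun + \<delta> id_blinfun = 0 + 0"
    by (metis real_vector_double_cancel add_0)
  then show ?thesis
    by (rule real_vector_double_cancel)
qed

section \<open>Resolvents inside A and second-order expansion\<close>

definition resolvent_inverse :: "('a \<Rightarrow>\<^sub>L 'a) \<Rightarrow> ('a \<Rightarrow>\<^sub>L 'a) \<Rightarrow> bool" where
  "resolvent_inverse T r \<longleftrightarrow>
     r \<in> A \<and> (id_blinfun - T) o\<^sub>L r = id_blinfun \<and> r o\<^sub>L (id_blinfun - T) = id_blinfun"

text \<open>The contractions r \<mapsto> 1 + Tr and r \<mapsto> 1 + rT of the complete set A have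
  fixed points, which are a right and a left inverse of 1 - T and hence coincide. Working within A
  matters: an inverse of an element of A need not lie in A in general.\<close>

lemma resolvent_inverse_exists:
  assumes T [simp]: "T \<in> A" and "norm T < 1"
  shows "\<exists>r. resolvent_inverse T r"
proof -
  have A: "complete A" "A \<noteq> {}"
    using closed id_mem by (auto simp: complete_eq_closed simp del: id_mem)
  have "\<exists>!r\<in>A. id_blinfun + (T o\<^sub>L r) = r"
  proof (rule Banach_fix [OF A norm_ge_zero \<open>norm T < 1\<close>])
    show "dist (id_blinfun + (T o\<^sub>L x)) (id_blinfun + (T o\<^sub>L y)) \<le> norm T * dist x y" for x y
      using norm_blinfun_compose [of T "x - y"] by (simp add: dist_norm blinfun_ring_simps)
  qed auto
  then obtain r where r: "r \<in> A" "id_blinfun + (T o\<^sub>L r) = r" by blast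
  have "\<exists>!r\<in>A. id_blinfun + (r o\<^sub>L T) = r"
  proof (rule Banach_fix [OF A norm_ge_zero \<open>norm T < 1\<close>])
    show "dist (id_blinfun + (x o\<^sub>L T)) (id_blinfun + (y o\<^sub>L T)) \<le> norm T * dist x y" for x y
      using norm_blinfun_compose [of "x - y" T] by (simp add: dist_norm blinfun_ring_simps)
  qed auto
  then obtain r' where r': "id_blinfun + (r' o\<^sub>L T) = r'" by blast
  have right: "(id_blinfun - T) o\<^sub>L r = id_blinfun"
    using r(2) by (simp add: blinfun_ring_simps)
  moreover have left: "r' o\<^sub>L (id_blinfun - T) = id_blinfun"
    using r' by (simp add: blinfun_ring_simps)
  moreover have "r' = r"
    using blinfun_compose_assoc [of r' "id_blinfun - T" r] left right by simp
  ultimately show ?thesis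
    using r(1) by (auto simp: resolvent_inverse_def)
qed

text \<open>Applying \<open>\<delta>_inverse\<close> to \<open>r = (1 - sT)\<inverse>\<close> gives
  \<open>2 \<delta> r = s (T \<delta> r + \<delta> r T + \<delta> T r + r \<delta> T)\<close>; for small \<open>s\<close> this equation determines \<open>\<delta> r\<close>, so
  the expansion holds without any continuity of \<open>\<delta>\<close>.\<close>

lemma \<delta>_resolvent_expansion:
  fixes s :: "'b \<Rightarrow> real"
  assumes T [simp]: "T \<in> A" and s0: "(s \<longlongrightarrow> 0) F" and nz: "\<forall>\<^sub>F t in F. s t \<noteq> 0"
    and r: "\<forall>\<^sub>F t in F. resolvent_inverse (s t *\<^sub>R T) (r t)"
  shows "((\<lambda>t. (1 / (s t)\<^sup>2) *\<^sub>R (\<delta> (r t) - s t *\<^sub>R \<delta> T)) \<longlongrightarrow> (\<delta> T o\<^sub>L T) + (T o\<^sub>L \<delta> T)) F"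
proof -
  have r_eq: "\<forall>\<^sub>F t in F. r t = id_blinfun + s t *\<^sub>R (T o\<^sub>L r t)"
    using r by eventually_elim (auto simp: resolvent_inverse_def blinfun_ring_simps)
  have \<delta>r_eq: "\<forall>\<^sub>F t in F. 2 *\<^sub>R \<delta> (r t) =
      s t *\<^sub>R ((T o\<^sub>L \<delta> (r t)) + (\<delta> (r t) o\<^sub>L T) + (\<delta> T o\<^sub>L r t) + (r t o\<^sub>L \<delta> T))"
    using r
  proof eventually_elim
    case (elim t)
    then have "(\<delta> (id_blinfun - s t *\<^sub>R T) o\<^sub>L r t) + ((id_blinfun - s t *\<^sub>R T) o\<^sub>L \<delta> (r t)) +
        (\<delta> (r t) o\<^sub>L (id_blinfun - s t *\<^sub>R T)) + (r t o\<^sub>L \<delta> (id_blinfun - s t *\<^sub>R T)) = 0"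
      by (intro \<delta>_inverse) (auto simp: resolvent_inverse_def)
    then show ?case
      by (simp add: \<delta>_diff \<delta>_scaleR \<delta>_id) (simp add: blinfun_ring_simps scaleR_2)
  qed
  have "((\<lambda>t. \<bar>s t\<bar> * norm T) \<longlongrightarrow> 0) F"
    using tendsto_mult [OF tendsto_rabs_zero [OF s0] tendsto_const [of "norm T"]] by simp
  \<comment> \<open>The bound 1/2 allows the terms in \<open>r t\<close>, and later those in
    \<open>\<delta> (r t)\<close>, to be absorbed into the left side of their own equations.\<close>
  then have small: "\<forall>\<^sub>F t in F. \<bar>s t\<bar> * norm T < 1 / 2"
    by (rule order_tendstoD) simp
  have r_bound: "\<forall>\<^sub>F t in F. norm (r t) \<le> 2"
    using r_eq small
  proof eventually_elim
    case (elim t)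
    have "norm (r t) \<le> norm (id_blinfun :: 'a \<Rightarrow>\<^sub>L 'a) + norm (s t *\<^sub>R (T o\<^sub>L r t))"
      by (subst elim(1)) (rule norm_triangle_ineq)
    also have "\<dots> \<le> 1 + \<bar>s t\<bar> * (norm T * norm (r t))"
      by (simp add: add_mono norm_blinfun_id_le mult_left_mono norm_blinfun_compose)
    also have "\<dots> \<le> 1 + 1 / 2 * norm (r t)"
      using elim(2) unfolding mult.assoc [symmetric]
      by (intro add_left_mono mult_right_mono) auto
    finally show ?case by simp
  qed
  \<comment> \<open>The two terms containing \<open>\<delta> (r t)\<close> contribute at most its
    norm, half of the left side; what remains bounds \<open>\<delta> (r t)\<close> by a multiple of
    s, replacing continuity of \<delta>.\<close>
  have \<delta>r_bound: "\<forall>\<^sub>F t in F. norm (\<delta> (r t)) \<le> 4 * \<bar>s t\<bar> * norm (\<delta> T)"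
    using \<delta>r_eq small r_bound
  proof eventually_elim
    case (elim t)
    have "2 * norm (\<delta> (r t)) = \<bar>s t\<bar> *
        norm ((T o\<^sub>L \<delta> (r t)) + (\<delta> (r t) o\<^sub>L T) + (\<delta> T o\<^sub>L r t) + (r t o\<^sub>L \<delta> T))"
      using arg_cong [OF elim(1), of norm] by simp
    also have "\<dots> \<le> \<bar>s t\<bar> * (norm T * norm (\<delta> (r t)) + norm (\<delta> (r t)) * norm T +
        norm (\<delta> T) * norm (r t) + norm (r t) * norm (\<delta> T))"
      by (intro mult_left_mono norm_triangle_mono norm_blinfun_compose) auto
    also have "\<dots> = 2 * ((\<bar>s t\<bar> * norm T) * norm (\<delta> (r t))) + 2 * (\<bar>s t\<bar> * norm (\<delta> T) * norm (r t))"
      by (simp add: algebra_simps)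
    also have "\<dots> \<le> 2 * (1 / 2 * norm (\<delta> (r t))) + 2 * (\<bar>s t\<bar> * norm (\<delta> T) * 2)"
      using elim(2,3) by (intro add_mono mult_left_mono mult_right_mono) auto
    finally show ?case by simp
  qed
  have \<delta>r_tendsto: "((\<lambda>t. \<delta> (r t)) \<longlongrightarrow> 0) F"
    by (rule Lim_null_comparison [OF \<delta>r_bound]) (auto intro!: tendsto_eq_intros s0)
  have r_tendsto: "(r \<longlongrightarrow> id_blinfun) F"
  proof (rule LIM_zero_cancel, rule Lim_null_comparison)
    show "\<forall>\<^sub>F t in F. norm (r t - id_blinfun) \<le> 2 * (\<bar>s t\<bar> * norm T)"
      using r_eq r_bound
    proof eventually_elim
      case (elim t)
      have "norm (r t - id_blinfun) = \<bar>s t\<bar> * norm (T o\<^sub>L r t)"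
        using arg_cong [OF elim(1), of "\<lambda>x. norm (x - id_blinfun)"] by simp
      also have "\<dots> \<le> \<bar>s t\<bar> * (norm T * 2)"
        using elim(2) by (intro mult_left_mono order_trans [OF norm_blinfun_compose]) auto
      finally show ?case by simp
    qed
  qed (auto intro!: tendsto_eq_intros s0)
  have \<delta>r_div_tendsto: "((\<lambda>t. (1 / s t) *\<^sub>R \<delta> (r t)) \<longlongrightarrow> \<delta> T) F"
  proof (rule Lim_transform_eventually)
    show "((\<lambda>t. (1 / 2) *\<^sub>R ((T o\<^sub>L \<delta> (r t)) + (\<delta> (r t) o\<^sub>L T) + (\<delta> T o\<^sub>L r t) + (r t o\<^sub>L \<delta> T)))
        \<longlongrightarrow> \<delta> T) F"
      by (auto intro!: tendsto_eq_intros \<delta>r_tendsto r_tendsto simp flip: scaleR_2)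
    show "\<forall>\<^sub>F t in F. (1 / 2) *\<^sub>R ((T o\<^sub>L \<delta> (r t)) + (\<delta> (r t) o\<^sub>L T) + (\<delta> T o\<^sub>L r t) +
        (r t o\<^sub>L \<delta> T)) = (1 / s t) *\<^sub>R \<delta> (r t)"
      using \<delta>r_eq nz
    proof eventually_elim
      case (elim t)
      show ?case
        using arg_cong [OF elim(1), of "scaleR (1 / (2 * s t))"] elim(2) by simp
    qed
  qed
  show ?thesis
  proof (rule Lim_transform_eventually)
    let ?g = "\<lambda>t. (1 / s t) *\<^sub>R \<delta> (r t)"
    show "((\<lambda>t. (1 / 2) *\<^sub>R ((T o\<^sub>L ?g t) + (?g t o\<^sub>L T) + (\<delta> T o\<^sub>L (T o\<^sub>L r t)) + (T o\<^sub>L r t o\<^sub>L \<delta> T)))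
        \<longlongrightarrow> (\<delta> T o\<^sub>L T) + (T o\<^sub>L \<delta> T)) F"
    proof (rule tendsto_eq_rhs)
      show "((\<lambda>t. (1 / 2) *\<^sub>R ((T o\<^sub>L ?g t) + (?g t o\<^sub>L T) + (\<delta> T o\<^sub>L (T o\<^sub>L r t)) + (T o\<^sub>L r t o\<^sub>L \<delta> T)))
          \<longlongrightarrow> (1 / 2) *\<^sub>R ((T o\<^sub>L \<delta> T) + (\<delta> T o\<^sub>L T) + (\<delta> T o\<^sub>L (T o\<^sub>L id_blinfun)) +
          (T o\<^sub>L id_blinfun o\<^sub>L \<delta> T))) F"
        by (intro tendsto_scaleR tendsto_add tendsto_const \<delta>r_div_tendsto r_tendsto
            bounded_bilinear.tendsto [OF bounded_bilinear_blinfun_compose])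
      have "(T o\<^sub>L \<delta> T) + (\<delta> T o\<^sub>L T) + (\<delta> T o\<^sub>L T) + (T o\<^sub>L \<delta> T) =
          2 *\<^sub>R ((\<delta> T o\<^sub>L T) + (T o\<^sub>L \<delta> T))"
        by (simp add: scaleR_2)
      then show "(1 / 2) *\<^sub>R ((T o\<^sub>L \<delta> T) + (\<delta> T o\<^sub>L T) + (\<delta> T o\<^sub>L (T o\<^sub>L id_blinfun)) +
          (T o\<^sub>L id_blinfun o\<^sub>L \<delta> T)) = (\<delta> T o\<^sub>L T) + (T o\<^sub>L \<delta> T)"
        by simp
    qed
    show "\<forall>\<^sub>F t in F. (1 / 2) *\<^sub>R ((T o\<^sub>L ?g t) + (?g t o\<^sub>L T) + (\<delta> T o\<^sub>L (T o\<^sub>L r t)) +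
        (T o\<^sub>L r t o\<^sub>L \<delta> T)) = (1 / (s t)\<^sup>2) *\<^sub>R (\<delta> (r t) - s t *\<^sub>R \<delta> T)"
      using \<delta>r_eq r_eq nz
    proof eventually_elim
      case (elim t)
      \<comment> \<open>Inserting r = 1 + sTr splits off 2\<delta>(T), which cancels the first-order
        term and leaves a further factor s.\<close>
      have "(\<delta> T o\<^sub>L r t) + (r t o\<^sub>L \<delta> T) =
          2 *\<^sub>R \<delta> T + s t *\<^sub>R ((\<delta> T o\<^sub>L (T o\<^sub>L r t)) + (T o\<^sub>L r t o\<^sub>L \<delta> T))"
        by (subst (1 2) elim(2)) (simp add: blinfun_ring_simps scaleR_2)
      then have "2 *\<^sub>R \<delta> (r t) = s t *\<^sub>R ((T o\<^sub>L \<delta> (r t)) + (\<delta> (r t) o\<^sub>L T) +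
          (2 *\<^sub>R \<delta> T + s t *\<^sub>R ((\<delta> T o\<^sub>L (T o\<^sub>L r t)) + (T o\<^sub>L r t o\<^sub>L \<delta> T))))"
        using elim(1) by (simp add: add.assoc)
      then have "(1 / (s t)\<^sup>2) *\<^sub>R (2 *\<^sub>R (\<delta> (r t) - s t *\<^sub>R \<delta> T)) =
          (1 / (s t)\<^sup>2) *\<^sub>R (s t *\<^sub>R ((T o\<^sub>L \<delta> (r t)) + (\<delta> (r t) o\<^sub>L T)) +
          (s t * s t) *\<^sub>R ((\<delta> T o\<^sub>L (T o\<^sub>L r t)) + (T o\<^sub>L r t o\<^sub>L \<delta> T)))"
        by (simp add: algebra_simps)
      also have "\<dots> = (T o\<^sub>L ?g t) + (?g t o\<^sub>L T) + (\<delta> T o\<^sub>L (T o\<^sub>L r t)) + (T o\<^sub>L r t o\<^sub>L \<delta> T)"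
        (is "_ = ?sum")
        using elim(3) by (simp add: blinfun_ring_simps power2_eq_square)
      finally have "?sum = (1 / (s t)\<^sup>2) *\<^sub>R (2 *\<^sub>R (\<delta> (r t) - s t *\<^sub>R \<delta> T))"
        by (rule sym)
      then show ?case by simp
    qed
  qed
qed

text \<open>The quotient of \<open>\<delta> (U t)\<close> by the square of t has two limits at 0.
  The second-order expansions of \<open>R t\<close> and \<open>R (- t)\<close> give the right side;
  the expansion for TT gives its first-order coefficient
  \<open>\<delta> (T o\<^sub>L T)\<close>.\<close>

theorem \<delta>_square:
  assumes T [simp]: "T \<in> A"
  shows "\<delta> (T o\<^sub>L T) = (\<delta> T o\<^sub>L T) + (T o\<^sub>L \<delta> T)" (is "_ = ?L")
proof -
  have "\<exists>r. \<bar>t\<bar> * norm T < 1 \<longrightarrow> resolvent_inverse (t *\<^sub>R T) r" for t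
    using resolvent_inverse_exists [of "t *\<^sub>R T"] by auto
  then obtain R where R: "\<bar>t\<bar> * norm T < 1 \<Longrightarrow> resolvent_inverse (t *\<^sub>R T) (R t)" for t
    by metis
  define U where "U t = (1 / 2) *\<^sub>R (R t + R (- t))" for t
  have "((\<lambda>t. \<bar>t\<bar> * norm T) \<longlongrightarrow> 0) (at 0)"
    by (auto intro!: tendsto_eq_intros)
  then have "\<forall>\<^sub>F t in at 0. \<bar>t\<bar> * norm T < 1"
    by (rule order_tendstoD) simp
  then have R_pos: "\<forall>\<^sub>F t in at 0. resolvent_inverse (t *\<^sub>R T) (R t)"
    and R_neg: "\<forall>\<^sub>F t in at 0. resolvent_inverse (- t *\<^sub>R T) (R (- t))"
    by (auto elim!: eventually_mono dest: R intro: R [of "- _", simplified])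
  have U: "\<forall>\<^sub>F t in at 0. resolvent_inverse (t\<^sup>2 *\<^sub>R (T o\<^sub>L T)) (U t)"
    using R_pos R_neg
  proof eventually_elim
    case (elim t)
    let ?p = "id_blinfun + t *\<^sub>R T" and ?m = "id_blinfun - t *\<^sub>R T"
    have factor: "id_blinfun - t\<^sup>2 *\<^sub>R (T o\<^sub>L T) = ?p o\<^sub>L ?m" "?p o\<^sub>L ?m = ?m o\<^sub>L ?p"
      by (simp_all add: blinfun_ring_simps power2_eq_square)
    have inv: "?m o\<^sub>L R t = id_blinfun" "R t o\<^sub>L ?m = id_blinfun"
      "?p o\<^sub>L R (- t) = id_blinfun" "R (- t) o\<^sub>L ?p = id_blinfun"
      using elim by (auto simp: resolvent_inverse_def)
    \<comment> \<open>As \<open>?p + ?m\<close> is twice the identity, these products show that the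
      average of \<open>R t\<close> and \<open>R (- t)\<close> inverts
      \<open>?p o\<^sub>L ?m\<close>.\<close>
    have "(?p o\<^sub>L ?m) o\<^sub>L R t = ?p" "(?p o\<^sub>L ?m) o\<^sub>L R (- t) = ?m"
      by (simp add: blinfun_compose_assoc inv) (simp add: factor(2) blinfun_compose_assoc inv)
    moreover have "R (- t) o\<^sub>L (?p o\<^sub>L ?m) = ?m" "R t o\<^sub>L (?p o\<^sub>L ?m) = ?p"
      by (simp add: inv flip: blinfun_compose_assoc)
        (simp add: factor(2) inv flip: blinfun_compose_assoc)
    ultimately show ?case
      using elim unfolding resolvent_inverse_def factor(1) U_def
      by (simp add: bounded_bilinear.scaleR_left [OF bounded_bilinear_blinfun_compose]
          bounded_bilinear.scaleR_right [OF bounded_bilinear_blinfun_compose]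
          bounded_bilinear.add_left [OF bounded_bilinear_blinfun_compose, of "R t" "R (- t)"]
          bounded_bilinear.add_right [OF bounded_bilinear_blinfun_compose, of _ "R t" "R (- t)"]
          flip: scaleR_2)
  qed
  have nz: "\<forall>\<^sub>F t::real in at 0. t \<noteq> 0"
    by (simp add: eventually_at_filter)
  have "((\<lambda>t. (1 / t\<^sup>2) *\<^sub>R (\<delta> (R t) - t *\<^sub>R \<delta> T) +
      (1 / (- t)\<^sup>2) *\<^sub>R (\<delta> (R (- t)) - (- t) *\<^sub>R \<delta> T)) \<longlongrightarrow> ?L + ?L) (at 0)"
    using nz R_pos R_neg
    by (intro tendsto_add \<delta>_resolvent_expansion) (auto intro!: tendsto_eq_intros)
  then have lim_R: "((\<lambda>t. (1 / 2) *\<^sub>R ((1 / t\<^sup>2) *\<^sub>R (\<delta> (R t) - t *\<^sub>R \<delta> T) +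
      (1 / (- t)\<^sup>2) *\<^sub>R (\<delta> (R (- t)) - (- t) *\<^sub>R \<delta> T))) \<longlongrightarrow> (1 / 2) *\<^sub>R (?L + ?L)) (at 0)"
    by (intro tendsto_scaleR tendsto_const)
  \<comment> \<open>The expansion with s(t) = \<open>t\<^sup>2\<close> and TT for T; the extra
    factor \<open>t\<^sup>2\<close> makes its second-order coefficient disappear in the
    limit.\<close>
  have "((\<lambda>t. t\<^sup>2 *\<^sub>R ((1 / (t\<^sup>2)\<^sup>2) *\<^sub>R (\<delta> (U t) - t\<^sup>2 *\<^sub>R \<delta> (T o\<^sub>L T))) + \<delta> (T o\<^sub>L T))
      \<longlongrightarrow> 0 *\<^sub>R ((\<delta> (T o\<^sub>L T) o\<^sub>L (T o\<^sub>L T)) + ((T o\<^sub>L T) o\<^sub>L \<delta> (T o\<^sub>L T))) + \<delta> (T o\<^sub>L T)) (at 0)"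
    using nz U
    by (intro tendsto_add tendsto_scaleR \<delta>_resolvent_expansion tendsto_const)
      (auto intro!: tendsto_eq_intros elim: eventually_mono)
  then have "((\<lambda>t. (1 / 2) *\<^sub>R ((1 / t\<^sup>2) *\<^sub>R (\<delta> (R t) - t *\<^sub>R \<delta> T) +
      (1 / (- t)\<^sup>2) *\<^sub>R (\<delta> (R (- t)) - (- t) *\<^sub>R \<delta> T)))
      \<longlongrightarrow> 0 *\<^sub>R ((\<delta> (T o\<^sub>L T) o\<^sub>L (T o\<^sub>L T)) + ((T o\<^sub>L T) o\<^sub>L \<delta> (T o\<^sub>L T))) + \<delta> (T o\<^sub>L T)) (at 0)"
  proof (rule Lim_transform_eventually)
    show "\<forall>\<^sub>F t in at 0. t\<^sup>2 *\<^sub>R ((1 / (t\<^sup>2)\<^sup>2) *\<^sub>R (\<delta> (U t) - t\<^sup>2 *\<^sub>R \<delta> (T o\<^sub>L T))) + \<delta> (T o\<^sub>L T) =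
      (1 / 2) *\<^sub>R ((1 / t\<^sup>2) *\<^sub>R (\<delta> (R t) - t *\<^sub>R \<delta> T) +
      (1 / (- t)\<^sup>2) *\<^sub>R (\<delta> (R (- t)) - (- t) *\<^sub>R \<delta> T))"
      using nz R_pos R_neg
    proof eventually_elim
      case (elim t)
      then have "\<delta> (U t) = (1 / 2) *\<^sub>R (\<delta> (R t) + \<delta> (R (- t)))"
        by (simp add: U_def resolvent_inverse_def \<delta>_scaleR \<delta>_add)
      then show ?case
        using elim(1) by (simp add: algebra_simps power2_eq_square)
    qed
  qed
  then show ?thesis
    using tendsto_unique [OF at_neq_bot _ lim_R] by (simp flip: scaleR_2)
qed

end

section \<open>Hilbert space geometry\<close>

\<comment> \<open>Makes the locale \<open>inverse_jordan_on\<close> available on Hilbert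
  spaces.\<close>
subclass (in complex_hilbert_space) banach ..

lemma cinner_add_right: "cinner x (y + z) = cinner x y + cinner x z"
  for x y z :: "'a::complex_hilbert_space"
  by (metis cinner_commute cinner_add_left complex_cnj_add)

lemma cinner_scaleC_right: "cinner x (c *\<^sub>C y) = cnj c * cinner x y"
  for x y :: "'a::complex_hilbert_space"
  by (metis cinner_commute cinner_scaleC_left complex_cnj_mult)

lemma cinner_diff_left: "cinner (x - y) z = cinner x z - cinner y z"
  for x y z :: "'a::complex_hilbert_space"
  using cinner_add_left [of "x - y" y z] by simp

lemma cinner_diff_right: "cinner x (y - z) = cinner x y - cinner x z"
  for x y z :: "'a::complex_hilbert_space"
  using cinner_add_right [of x "y - z" z] by simp

lemma cinner_zero_left [simp]: "cinner 0 x = 0"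
  and cinner_zero_right [simp]: "cinner x 0 = 0"
  for x :: "'a::complex_hilbert_space"
  using cinner_diff_left [of 0 0 x] cinner_diff_right [of x 0 0] by simp_all

lemma cinner_self_eq_0_iff [simp]: "cinner x x = 0 \<longleftrightarrow> x = 0"
  for x :: "'a::complex_hilbert_space"
  by (simp add: cinner_self)

section \<open>Norm identities, Cauchy-Schwarz and orthogonal projection\<close>

lemma norm_add_square:
  "(norm (x + y))\<^sup>2 = (norm x)\<^sup>2 + 2 * Re (cinner x y) + (norm y)\<^sup>2"
  for x y :: "'a::complex_hilbert_space"
proof -
  have "cinner (x + y) (x + y) = cinner x x + cinner x y + cnj (cinner x y) + cinner y y"
    by (simp add: cinner_add_left cinner_add_right flip: cinner_commute)
  then show ?thesis
    by (simp add: cinner_self complex_eq_iff)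
qed

lemma norm_diff_square:
  "(norm (x - y))\<^sup>2 = (norm x)\<^sup>2 - 2 * Re (cinner x y) + (norm y)\<^sup>2"
  for x y :: "'a::complex_hilbert_space"
  using norm_add_square [of "x - y" y]
  by (simp add: cinner_diff_left cinner_self power2_eq_square)

lemma parallelogram_law:
  "(norm (x - y))\<^sup>2 + (norm (x + y))\<^sup>2 = 2 * (norm x)\<^sup>2 + 2 * (norm y)\<^sup>2"
  for x y :: "'a::complex_hilbert_space"
  by (simp add: norm_add_square norm_diff_square)

text \<open>Removing from x its component along v. Nonnegativity of the left side is Cauchy-Schwarz,
  and its comparison with a minimal distance yields orthogonality.\<close>

lemma norm_diff_component_square:
  fixes x v :: "'a::complex_hilbert_space"
  assumes "v \<noteq> 0"
  shows "(norm (x - (cinner x v / (norm v)\<^sup>2) *\<^sub>C v))\<^sup>2 =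
    (norm x)\<^sup>2 - (cmod (cinner x v))\<^sup>2 / (norm v)\<^sup>2"
proof -
  define \<alpha> where "\<alpha> = cinner x v"
  define \<beta> where "\<beta> = \<alpha> / (norm v)\<^sup>2"
  have "cmod \<beta> = cmod \<alpha> / (norm v)\<^sup>2"
    by (simp add: \<beta>_def norm_divide norm_power)
  then have "(norm (\<beta> *\<^sub>C v))\<^sup>2 = (cmod \<alpha>)\<^sup>2 / (norm v)\<^sup>2"
    using assms by (simp add: norm_scaleC power2_eq_square)
  moreover have "Re (cnj \<beta> * \<alpha>) = (cmod \<alpha>)\<^sup>2 / (norm v)\<^sup>2"
    unfolding \<beta>_def cmod_power2 by (simp add: power2_eq_square flip: of_real_mult)
  ultimately have "(norm (x - \<beta> *\<^sub>C v))\<^sup>2 = (norm x)\<^sup>2 - (cmod \<alpha>)\<^sup>2 / (norm v)\<^sup>2"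
    unfolding norm_diff_square cinner_scaleC_right \<alpha>_def [symmetric] by simp
  then show ?thesis
    by (simp only: \<beta>_def \<alpha>_def)
qed

lemma cmod_cinner_le: "cmod (cinner x y) \<le> norm x * norm y"
  for x y :: "'a::complex_hilbert_space"
proof (cases "y = 0")
  case False
  have "0 \<le> (norm x)\<^sup>2 - (cmod (cinner x y))\<^sup>2 / (norm y)\<^sup>2"
    unfolding norm_diff_component_square [OF False, symmetric] by simp
  then have "(cmod (cinner x y))\<^sup>2 \<le> (norm x * norm y)\<^sup>2"
    using False by (simp add: field_simps)
  then show ?thesis
    by (rule power2_le_imp_le) simp
qed simp

text \<open>A minimising sequence is Cauchy by the parallelogram law, since midpoints of its members
  stay in M and are at distance at least d from x.\<close>

lemma closest_point_exists:
  fixes x :: "'a::complex_hilbert_space"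
  assumes M: "csubspace M" and "closed M"
  shows "\<exists>y\<in>M. \<forall>z\<in>M. norm (x - y) \<le> norm (x - z)"
proof -
  define d where "d = infdist x M"
  have M0: "M \<noteq> {}" using complex_vector.subspace_0 [OF M] by auto
  have d_le: "d \<le> norm (x - z)" if "z \<in> M" for z
    using infdist_le [OF that, of x] by (simp add: d_def dist_norm)
  have d0: "0 \<le> d" by (simp add: d_def infdist_nonneg)
  have "\<exists>y\<in>M. norm (x - y) < d + 1 / real (Suc n)" for n
  proof (rule ccontr)
    assume "\<not> ?thesis"
    then have "d + 1 / real (Suc n) \<le> infdist x M"
      using M0 unfolding infdist_notempty [OF M0]
      by (intro cINF_greatest) (auto simp: dist_norm not_less)
    then show False
      unfolding d_def by (simp add: field_simps)
  qed
  then obtain y where y: "y n \<in> M" "norm (x - y n) < d + 1 / real (Suc n)" for n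
    by metis
  have "(\<lambda>n. norm (x - y n)) \<longlonglongrightarrow> d"
  proof (rule tendsto_sandwich [where f = "\<lambda>_. d"])
    show "(\<lambda>n. d + 1 / real (Suc n)) \<longlonglongrightarrow> d"
      using tendsto_add [OF tendsto_const LIMSEQ_Suc [OF lim_1_over_n], of d] by simp
  qed (use d_le y less_imp_le [OF y(2)] in auto)
  then have lim: "(\<lambda>n. (norm (x - y n))\<^sup>2) \<longlonglongrightarrow> d\<^sup>2"
    by (rule tendsto_power)
  have par: "(norm (y i - y j))\<^sup>2 \<le> 2 * ((norm (x - y i))\<^sup>2 - d\<^sup>2) + 2 * ((norm (x - y j))\<^sup>2 - d\<^sup>2)"
    for i j
  proof -
    let ?u = "x - y i" and ?v = "x - y j"
    have "(norm (?u - ?v))\<^sup>2 + (norm (?u + ?v))\<^sup>2 = 2 * (norm ?u)\<^sup>2 + 2 * (norm ?v)\<^sup>2"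
      by (rule parallelogram_law)
    moreover have "?u + ?v = 2 *\<^sub>R (x - (1 / 2) *\<^sub>R (y i + y j))"
      by (simp add: algebra_simps scaleR_2)
    moreover have "(1 / 2) *\<^sub>R (y i + y j) \<in> M"
      unfolding scaleR_scaleC using y M
      by (intro complex_vector.subspace_scale complex_vector.subspace_add) auto
    then have "d\<^sup>2 \<le> (norm (x - (1 / 2) *\<^sub>R (y i + y j)))\<^sup>2"
      by (intro power_mono d_le d0)
    moreover have "norm (?u - ?v) = norm (y i - y j)"
      by (simp add: norm_minus_commute)
    ultimately show ?thesis by (simp add: power_mult_distrib)
  qed
  have "Cauchy y"
  proof (rule CauchyI)
    fix e :: real assume "0 < e"
    then have "\<forall>\<^sub>F n in sequentially. (norm (x - y n))\<^sup>2 < d\<^sup>2 + e\<^sup>2 / 4"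
      by (intro order_tendstoD [OF lim]) simp
    then obtain N where N: "\<And>n. n \<ge> N \<Longrightarrow> (norm (x - y n))\<^sup>2 < d\<^sup>2 + e\<^sup>2 / 4"
      by (auto simp: eventually_sequentially)
    have "norm (y i - y j) < e" if "i \<ge> N" "j \<ge> N" for i j
    proof (rule power2_less_imp_less)
      show "(norm (y i - y j))\<^sup>2 < e\<^sup>2"
        using par [of i j] N [OF that(1)] N [OF that(2)] by argo
    qed (use \<open>0 < e\<close> in simp)
    then show "\<exists>N. \<forall>i\<ge>N. \<forall>j\<ge>N. norm (y i - y j) < e" by blast
  qed
  then obtain l where l: "y \<longlonglongrightarrow> l"
    by (auto simp: Cauchy_convergent_iff convergent_def)
  have "l \<in> M"
    using closed_sequentially [OF \<open>closed M\<close> _ l] y by auto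
  moreover have "(\<lambda>n. norm (x - y n)) \<longlonglongrightarrow> norm (x - l)"
    by (intro tendsto_intros l)
  then have "norm (x - l) = d"
    using \<open>(\<lambda>n. norm (x - y n)) \<longlonglongrightarrow> d\<close> by (rule LIMSEQ_unique)
  ultimately show ?thesis using d_le by auto
qed

lemma orthogonal_projection_exists:
  fixes M :: "'a::complex_hilbert_space set"
  assumes M: "csubspace M" and "closed M"
  obtains P where "P \<in> cblinfuns" "\<And>x. blinfun_apply P x \<in> M"
    "\<And>x. x \<in> M \<Longrightarrow> blinfun_apply P x = x"
    "\<And>x w. w \<in> M \<Longrightarrow> cinner (x - blinfun_apply P x) w = 0"
proof -
  note mem = complex_vector.subspace_add [OF M] complex_vector.subspace_diff [OF M]
    complex_vector.subspace_scale [OF M]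
  have "\<exists>y\<in>M. \<forall>w\<in>M. cinner (x - y) w = 0" for x
  proof -
    obtain y where y: "y \<in> M" "\<And>z. z \<in> M \<Longrightarrow> norm (x - y) \<le> norm (x - z)"
      using closest_point_exists [OF assms] by blast
    have "cinner (x - y) w = 0" if "w \<in> M" for w
    proof (cases "w = 0")
      case False
      let ?c = "cinner (x - y) w / (norm w)\<^sup>2"
      have "(norm (x - y))\<^sup>2 \<le> (norm (x - (y + ?c *\<^sub>C w)))\<^sup>2"
        by (intro power_mono y mem that) auto
      also have "x - (y + ?c *\<^sub>C w) = (x - y) - ?c *\<^sub>C w" by simp
      also have "(norm ((x - y) - ?c *\<^sub>C w))\<^sup>2 =
          (norm (x - y))\<^sup>2 - (cmod (cinner (x - y) w))\<^sup>2 / (norm w)\<^sup>2"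
        by (rule norm_diff_component_square [OF False])
      finally have "(cmod (cinner (x - y) w))\<^sup>2 \<le> 0"
        using False by (simp add: divide_le_0_iff)
      then show ?thesis by simp
    qed simp
    then show ?thesis using y(1) by blast
  qed
  then obtain p where "\<forall>x. p x \<in> M \<and> (\<forall>w\<in>M. cinner (x - p x) w = 0)"
    by metis
  then have p: "p x \<in> M" "w \<in> M \<Longrightarrow> cinner (x - p x) w = 0" for x w
    by auto
  \<comment> \<open>Uniqueness of the orthogonal decomposition, from which the linearity of p and p
    x = x on M follow.\<close>
  have p_eq: "p x = y" if "y \<in> M" "\<And>w. w \<in> M \<Longrightarrow> cinner (x - y) w = 0" for x y
  proof -
    have "p x - y \<in> M" by (intro mem p that)
    then have "cinner (x - y) (p x - y) - cinner (x - p x) (p x - y) = 0"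
      using p(2) that(2) by simp
    then have "cinner ((x - y) - (x - p x)) (p x - y) = 0"
      by (simp only: cinner_diff_left)
    moreover have "(x - y) - (x - p x) = p x - y" by simp
    ultimately have "cinner (p x - y) (p x - y) = 0" by simp
    then show ?thesis by simp
  qed
  have add: "p (x + x') = p x + p x'" for x x'
  proof (rule p_eq)
    show "cinner (x + x' - (p x + p x')) w = 0" if "w \<in> M" for w
      using p(2) [OF that, of x] p(2) [OF that, of x']
      by (simp add: cinner_diff_left cinner_add_left)
  qed (simp add: mem p)
  have scale: "p (c *\<^sub>C x) = c *\<^sub>C p x" for c x
  proof (rule p_eq)
    show "cinner (c *\<^sub>C x - c *\<^sub>C p x) w = 0" if "w \<in> M" for w
      using p(2) [OF that, of x] by (simp add: cinner_diff_left cinner_scaleC_left)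
  qed (simp add: mem p)
  have "norm (p x) \<le> norm x * 1" for x
  proof -
    \<comment> \<open>Pythagoras for the orthogonal vectors x - p x and p x.\<close>
    have "(norm x)\<^sup>2 = (norm (x - p x))\<^sup>2 + (norm (p x))\<^sup>2"
      using norm_add_square [of "x - p x" "p x"] p by simp
    then have "(norm (p x))\<^sup>2 \<le> (norm x)\<^sup>2" by simp
    then show ?thesis
      using power2_le_imp_le [of "norm (p x)" "norm x"] by simp
  qed
  then have "bounded_linear p"
    by (intro bounded_linear_intro [where K = 1]) (simp_all add: add scale scaleR_scaleC)
  then have "blinfun_apply (Blinfun p) = p"
    by (rule bounded_linear_Blinfun_apply)
  moreover have "p x = x" if "x \<in> M" for x
    using that by (intro p_eq) auto
  ultimately show thesis
    using p scale by (intro that [of "Blinfun p"]) (auto simp: cblinfuns_def)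
qed

section \<open>Rank-one operators and primeness of the full operator algebra\<close>

definition rank_one :: "'a::complex_hilbert_space \<Rightarrow> 'a \<Rightarrow> 'a \<Rightarrow>\<^sub>L 'a" where
  "rank_one u v = Blinfun (\<lambda>x. cinner x v *\<^sub>C u)"

lemma rank_one_apply [simp]: "blinfun_apply (rank_one u v) x = cinner x v *\<^sub>C u"
proof -
  have "bounded_linear (\<lambda>x. cinner x v *\<^sub>C u)"
  proof (rule bounded_linear_intro [where K = "norm v * norm u"])
    show "norm (cinner x v *\<^sub>C u) \<le> norm x * (norm v * norm u)" for x
      using mult_right_mono [OF cmod_cinner_le, of "norm u"] by (simp add: norm_scaleC mult.assoc)
  qed (simp_all add: cinner_add_left cinner_scaleC_left scaleR_scaleC scaleC_add_left scaleC_scaleC)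
  then show ?thesis
    by (simp add: rank_one_def bounded_linear_Blinfun_apply)
qed

lemma rank_one_mem_cblinfuns: "rank_one u v \<in> cblinfuns"
  by (simp add: cblinfuns_def cinner_scaleC_left scaleC_scaleC)

text \<open>Testing with z = \<open>rank_one x (b y)\<close> and evaluating at y gives a linear
  relation between a x and b x, with the nonzero coefficient \<open>cinner (b y) (b y)\<close> at a
  x.\<close>

lemma cblinfuns_prime:
  fixes a b :: "'a::complex_hilbert_space \<Rightarrow>\<^sub>L 'a"
  assumes a: "a \<in> cblinfuns" and b: "b \<in> cblinfuns"
    and ab: "\<And>z. z \<in> cblinfuns \<Longrightarrow> (a o\<^sub>L z o\<^sub>L b) + (b o\<^sub>L z o\<^sub>L a) = 0"
  shows "a = 0 \<or> b = 0"
proof (rule disjCI)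
  assume "b \<noteq> 0"
  then obtain y where y: "b y \<noteq> 0"
    using blinfun_eqI [of b 0] by auto
  let ?v = "blinfun_apply b y"
  have eq: "cinner ?v ?v *\<^sub>C a x + cinner (a y) ?v *\<^sub>C b x = 0" for x
  proof -
    have "((a o\<^sub>L rank_one x ?v o\<^sub>L b) + (b o\<^sub>L rank_one x ?v o\<^sub>L a)) y = 0"
      by (simp add: ab rank_one_mem_cblinfuns)
    then show ?thesis
      using a b by (simp add: blinfun.add_left cblinfuns_def)
  qed
  \<comment> \<open>With x = y, pairing against b y gives twice \<open>cinner (a y) (b y)\<close>
    times the squared norm of b y, so the coefficient of b x vanishes.\<close>
  have "cinner (cinner ?v ?v *\<^sub>C a y + cinner (a y) ?v *\<^sub>C b y) ?v = 0"
    unfolding eq by simp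
  then have "cinner (a y) ?v = 0"
    using y by (simp add: cinner_add_left cinner_scaleC_left)
  then have "a x = 0" for x
    using eq [of x] y by simp
  then show "a = 0" by (intro blinfun_eqI) simp
qed

section \<open>Nest algebras\<close>

lemma nest_alg_iff:
  "x \<in> nest_alg \<N> \<longleftrightarrow> (\<forall>c v. x (c *\<^sub>C v) = c *\<^sub>C x v) \<and> (\<forall>M\<in>\<N>. \<forall>v\<in>M. x v \<in> M)"
  by (auto simp: nest_alg_def cblinfuns_def image_subset_iff)

lemma nest_alg_id: "id_blinfun \<in> nest_alg \<N>"
  by (simp add: nest_alg_iff)

lemma nest_alg_compose: "x \<in> nest_alg \<N> \<Longrightarrow> y \<in> nest_alg \<N> \<Longrightarrow> x o\<^sub>L y \<in> nest_alg \<N>"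
  by (simp add: nest_alg_iff)

lemma nest_alg_subspace:
  fixes \<N> :: "'a::complex_normed_vector set set"
  assumes "nest \<N>"
  shows "subspace (nest_alg \<N>)"
proof -
  have N: "csubspace M" if "M \<in> \<N>" for M
    using assms that by (auto simp: nest_def)
  have scaleR: "blinfun_apply (r *\<^sub>R x) v = complex_of_real r *\<^sub>C x v"
    for r and x :: "'a \<Rightarrow>\<^sub>L 'a" and v
    by (subst blinfun.scaleR_left) (rule scaleR_scaleC)
  show ?thesis
    by (auto simp: subspace_def nest_alg_iff blinfun.add_left scaleR scaleC_add_right scaleC_scaleC
        mult.commute intro: complex_vector.subspace_0 complex_vector.subspace_add
        complex_vector.subspace_scale N)
qed

lemma nest_alg_closed:
  fixes \<N> :: "'a::complex_normed_vector set set"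
  assumes "nest \<N>"
  shows "closed (nest_alg \<N>)"
proof -
  have N: "closed M" if "M \<in> \<N>" for M
    using assms that by (auto simp: nest_def)
  have cont: "continuous_on UNIV (\<lambda>x :: 'a \<Rightarrow>\<^sub>L 'a. x v)" for v
    by (intro continuous_intros)
  have "nest_alg \<N> = (\<Inter>c. \<Inter>v. {x :: 'a \<Rightarrow>\<^sub>L 'a. x (c *\<^sub>C v) = c *\<^sub>C x v}) \<inter>
      (\<Inter>M\<in>\<N>. \<Inter>v\<in>M. (\<lambda>x. blinfun_apply x v) -` M)"
    by (auto simp: nest_alg_iff)
  moreover have "closed \<dots>"
    by (intro closed_Int closed_INT ballI closed_Collect_eq closed_vimage cont N
        bounded_linear.continuous_on [OF bounded_linear_scaleC])
  ultimately show ?thesis by simp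
qed

text \<open>Exchanging x and y exchanges the coefficients m and n, so the two instances add up to m
  + n times a symmetric expression.\<close>

lemma derivable_at_id_imp_inverse:
  fixes \<delta> :: "('a::complex_normed_vector \<Rightarrow>\<^sub>L 'a) \<Rightarrow> ('a \<Rightarrow>\<^sub>L 'a)"
  assumes \<delta>: "derivable_at m n A id_blinfun \<delta>" and mn: "m + n \<noteq> 0"
    and id: "id_blinfun \<in> A" and "x \<in> A" "y \<in> A" "x o\<^sub>L y = id_blinfun" "y o\<^sub>L x = id_blinfun"
  shows "(\<delta> x o\<^sub>L y) + (x o\<^sub>L \<delta> y) + (\<delta> y o\<^sub>L x) + (y o\<^sub>L \<delta> x) = 0"
proof -
  let ?k = "of_int m + of_int n :: complex"
  have k: "?k \<noteq> 0" using mn by (simp flip: of_int_add)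
  have sum: "\<delta> id_blinfun + \<delta> id_blinfun =
      (\<delta> x o\<^sub>L y) + (x o\<^sub>L \<delta> y) + (\<delta> y o\<^sub>L x) + (y o\<^sub>L \<delta> x)"
    if "x \<in> A" "y \<in> A" "x o\<^sub>L y = id_blinfun" "y o\<^sub>L x = id_blinfun" for x y
  proof -
    have eq: "of_int m *\<^sub>C \<delta> id_blinfun + of_int n *\<^sub>C \<delta> id_blinfun =
        of_int m *\<^sub>C (\<delta> u o\<^sub>L v) + of_int m *\<^sub>C (u o\<^sub>L \<delta> v) +
        of_int n *\<^sub>C (\<delta> v o\<^sub>L u) + of_int n *\<^sub>C (v o\<^sub>L \<delta> u)"
      if "u \<in> A" "v \<in> A" "u o\<^sub>L v = id_blinfun" "v o\<^sub>L u = id_blinfun" for u v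
    proof -
      have "of_int m *\<^sub>C \<delta> (u o\<^sub>L v) + of_int n *\<^sub>C \<delta> (v o\<^sub>L u) =
        of_int m *\<^sub>C (\<delta> u o\<^sub>L v) + of_int m *\<^sub>C (u o\<^sub>L \<delta> v) +
        of_int n *\<^sub>C (\<delta> v o\<^sub>L u) + of_int n *\<^sub>C (v o\<^sub>L \<delta> u)"
        using \<delta> that unfolding derivable_at_def by blast
      then show ?thesis using that by simp
    qed
    have "?k *\<^sub>C (\<delta> id_blinfun + \<delta> id_blinfun) =
        ?k *\<^sub>C ((\<delta> x o\<^sub>L y) + (x o\<^sub>L \<delta> y) + (\<delta> y o\<^sub>L x) + (y o\<^sub>L \<delta> x))"
      using arg_cong2 [OF eq [OF that] eq [OF that(2,1,4,3)], of "(+)"]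
      by (simp add: scaleC_add_left scaleC_add_right algebra_simps)
    then show ?thesis
      using k by (simp only: complex_vector.scale_cancel_left) simp
  qed
  \<comment> \<open>For x = y = 1 the right side of \<open>sum\<close> is 4\<delta>(1), while the
    left side is 2\<delta>(1).\<close>
  have "(\<delta> id_blinfun + \<delta> id_blinfun) = 0"
    using sum [OF id id] by (simp add: add.assoc)
  then show ?thesis
    using sum assms by metis
qed

theorem corollary4p6:
  fixes m n :: int
    and \<N> :: "'h::complex_hilbert_space set set"
    and \<delta> :: "('h \<Rightarrow>\<^sub>L 'h) \<Rightarrow> ('h \<Rightarrow>\<^sub>L 'h)"
  assumes "m \<noteq> 0" and "n \<noteq> 0" and "m + n \<noteq> 0"
    and "separable_space (euclidean :: 'h topology)"
    and "nest \<N>"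
    and "derivable_at m n (nest_alg \<N>) id_blinfun \<delta>"
  shows "derivation (nest_alg \<N>) \<delta>"
proof -
  let ?A = "nest_alg \<N>"
  have lin: "linear_self_map ?A \<delta>"
    using assms(6) by (simp add: derivable_at_def)
  interpret inverse_jordan_on ?A \<delta>
  proof unfold_locales
    show "\<delta> (r *\<^sub>R x) = r *\<^sub>R \<delta> x" if "x \<in> ?A" for r x
      using lin that by (simp add: linear_self_map_def scaleR_scaleC)
  qed (use lin in \<open>auto simp: linear_self_map_def nest_alg_closed nest_alg_subspace assms(5)
      nest_alg_id nest_alg_compose intro: derivable_at_id_imp_inverse [OF assms(6,3)]\<close>)
  interpret jordan_derivation_on ?A \<delta>
    using lin by unfold_locales (auto simp: linear_self_map_def \<delta>_square)
  have "\<delta> (x o\<^sub>L y) = (\<delta> x o\<^sub>L y) + (x o\<^sub>L \<delta> y)" if xy: "x \<in> ?A" "y \<in> ?A" for x y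
  proof (cases "\<N> \<subseteq> {{0}, UNIV}")
    case True
    then have A: "?A = cblinfuns"
      by (auto simp: nest_alg_def)
    show ?thesis
      by (rule prime_imp_derivation [OF cblinfuns_prime [where 'a = 'h, folded A] xy])
  next
    case False
    then obtain M where M: "M \<in> \<N>" "M \<noteq> {0}" "M \<noteq> UNIV" by blast
    then have subspace_M: "csubspace M" and closed_M: "closed M"
      using assms(5) by (auto simp: nest_def)
    obtain u0 v0 where u0: "u0 \<in> M" "u0 \<noteq> 0" and v0: "v0 \<notin> M"
      using M complex_vector.subspace_0 [OF subspace_M] by auto
    obtain P where P: "P \<in> cblinfuns" "\<And>x. blinfun_apply P x \<in> M"
        "\<And>x. x \<in> M \<Longrightarrow> blinfun_apply P x = x"
      and orth: "\<And>x w. w \<in> M \<Longrightarrow> cinner (x - blinfun_apply P x) w = 0"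
      by (rule orthogonal_projection_exists [OF subspace_M closed_M]) (blast intro: that)
    have comparable: "L \<subseteq> M \<or> M \<subseteq> L" if "L \<in> \<N>" for L
      using assms(5) M(1) that by (auto simp: nest_def chain_subset_def)
    have orth': "cinner w (x - blinfun_apply P x) = 0" if "w \<in> M" for x w
      using orth [OF that] cinner_commute [of w] by simp
    \<comment> \<open>A member of the nest inside M is fixed pointwise by P; one containing M
      contains the range of P.\<close>
    have P_mem: "P \<in> ?A"
      using P(1) P(2,3) comparable by (auto simp: nest_alg_def) (metis subsetD)
    define K where "K = {v. \<forall>w\<in>M. cinner w v = 0}"
    \<comment> \<open>K is the orthogonal complement of M. The operator kills every nest member
      inside M and maps into every member containing M; it also satisfies PR = R and RP = 0, so it
      lies in the corner PA(1 - P).\<close>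
    have corner: "rank_one u v \<in> ?A" "(P o\<^sub>L rank_one u v) - (rank_one u v o\<^sub>L P) = rank_one u v"
      if "u \<in> M" "v \<in> K" for u v
    proof -
      have "cinner w v *\<^sub>C u \<in> L" if "L \<in> \<N>" "w \<in> L" for w L
        using comparable [OF \<open>L \<in> \<N>\<close>]
      proof
        assume "L \<subseteq> M"
        then have "cinner w v = 0"
          using that \<open>v \<in> K\<close> by (auto simp: K_def)
        then show ?thesis
          using that assms(5) by (simp add: nest_def complex_vector.subspace_0)
      next
        assume "M \<subseteq> L"
        then show ?thesis
          using that \<open>u \<in> M\<close> assms(5) by (intro complex_vector.subspace_scale) (auto simp: nest_def)
      qed
      then show "rank_one u v \<in> ?A"
        using rank_one_mem_cblinfuns by (auto simp: nest_alg_def)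
      show "(P o\<^sub>L rank_one u v) - (rank_one u v o\<^sub>L P) = rank_one u v"
        using that P by (intro blinfun_eqI) (simp add: blinfun.diff_left K_def cblinfuns_def)
    qed
    show ?thesis
    proof (rule triangular_imp_derivation [OF P_mem _ _ _ _ xy])
      show "P o\<^sub>L P = P"
        using P by (intro blinfun_eqI) simp
      show "P o\<^sub>L x o\<^sub>L P = x o\<^sub>L P" if "x \<in> ?A" for x
        using P that M(1) by (intro blinfun_eqI) (simp add: nest_alg_iff)
    next
      fix d
      assume "d \<in> ?A" and d: "\<And>x. x \<in> ?A \<Longrightarrow> d o\<^sub>L ((P o\<^sub>L x) - (x o\<^sub>L P)) = 0"
      \<comment> \<open>A nonzero vector orthogonal to M, available because M is proper. Evaluating
        d after \<open>rank_one u ?v\<close> at this vector gives a nonzero multiple of d u.\<close>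
      let ?v = "v0 - blinfun_apply P v0"
      have "?v \<in> K" "?v \<noteq> 0"
        using orth' P(2) [of v0] v0 by (auto simp: K_def)
      have "d u = 0" if "u \<in> M" for u
      proof -
        have "(d o\<^sub>L rank_one u ?v) ?v = 0"
          using d [OF corner(1)] corner(2) that \<open>?v \<in> K\<close> by simp
        then show ?thesis
          using \<open>?v \<noteq> 0\<close> \<open>d \<in> ?A\<close> by (simp add: nest_alg_iff)
      qed
      then show "d o\<^sub>L P = 0"
        using P by (intro blinfun_eqI) simp
    next
      fix d
      assume "d \<in> ?A" and d: "\<And>x. x \<in> ?A \<Longrightarrow> ((P o\<^sub>L x) - (x o\<^sub>L P)) o\<^sub>L d = 0"
      show "P o\<^sub>L d = d"
      proof (rule blinfun_eqI)
        fix y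
        \<comment> \<open>The component of d y orthogonal to M. The hypothesis makes it orthogonal
          to d y, and it is orthogonal to P (d y) in M, hence to itself.\<close>
        let ?v = "d y - P (d y)"
        have "?v \<in> K" using orth' by (simp add: K_def)
        then have "rank_one u0 ?v o\<^sub>L d = 0"
          using d [OF corner(1)] corner(2) u0 by simp
        then have "(rank_one u0 ?v o\<^sub>L d) y = 0" by simp
        then have "cinner (d y) ?v = 0"
          using u0 by simp
        moreover have "cinner (P (d y)) ?v = 0"
          by (rule orth' [OF P(2)])
        ultimately have "cinner ?v ?v = 0"
          by (simp only: cinner_diff_left) simp
        then show "(P o\<^sub>L d) y = d y" by simp
      qed
    qed
  qed
  then show ?thesis
    using lin by (simp add: derivation_def)
qed

end
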